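(* Let $G=(V,E)$ be an undirected graph with $|V|=n$. Fix any $\alpha \geq 1$, $d \geq 0$, $\epsilon \in (0,1)$, and $L = 2 + \lceil \log_{(1+\epsilon)} n \rceil$. Let $d^*= \max_{S \subseteq V} \rho(S)$, and let $(Z_1, \ldots, Z_L)$ be an $(\alpha, d, L)$-decomposition of $G$. Then: 1. If $d > 2 (1+\epsilon)d^*$, then $Z_L = \emptyset$. 2. Else if $d < d^*/\alpha$, then $Z_L \ne \emptyset$ and there is an index $j \in \{1, \ldots, L-1\}$ such that $\rho(Z_j) \geq d/(2(1+\epsilon))$.
   Context: For nonempty $S\subseteq V$, $\rho(S)=|E(S)|/|S|$, where $E(S)$ is the set of edges with both endpoints in $S$. For $v\in V$ and $S\subseteq V$, $D_v(S)$ denotes the number of neighbors of $v$ lying in $S$. Given $\alpha\ge1$, $d\ge0$ and a positive integer $L$, a tuple $(Z_1,\dots,Z_L)$ of subsets with $Z_1\supseteq Z_2\supseteq\cdots\supseteq Z_L$ is an $(\alpha,d,L)$-decomposition of $G$ iff $Z_1=V$ and for every $i\in\{1,\dots,L-1\}$: $Z_{i+1}\supseteq\{v\in Z_i: D_v(Z_i)>\alpha d\}$ and $Z_{i+1}\cap\{v\in Z_i: D_v(Z_i)<d\}=\emptyset$. *)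

theory Defs
  imports Complex_Main
begin

text \<open>An edge is the two-element set of its endpoints, so there are neither loops nor parallel
  edges.\<close>

definition simple_graph :: "'a set \<Rightarrow> 'a set set \<Rightarrow> bool" where
  "simple_graph V E \<longleftrightarrow> finite V \<and> (\<forall>e\<in>E. e \<subseteq> V \<and> card e = 2)"

definition induced_edges :: "'a set set \<Rightarrow> 'a set \<Rightarrow> 'a set set" where
  "induced_edges E S = {e \<in> E. e \<subseteq> S}"

text \<open>Meaningful for finite nonempty \<open>S\<close> only.\<close>

definition density :: "'a set set \<Rightarrow> 'a set \<Rightarrow> real" where
  "density E S = real (card (induced_edges E S)) / real (card S)"

definition max_density :: "'a set \<Rightarrow> 'a set set \<Rightarrow> real" where
  "max_density V E = Max {density E S | S. S \<subseteq> V \<and> S \<noteq> {}}"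

definition deg_in :: "'a set set \<Rightarrow> 'a \<Rightarrow> 'a set \<Rightarrow> nat" where
  "deg_in E v S = card {u \<in> S. {u, v} \<in> E}"

text \<open>The tuple is a function on indices; only its values at \<open>1, \<dots>, L\<close> matter.\<close>

definition is_decomposition ::
  "'a set \<Rightarrow> 'a set set \<Rightarrow> real \<Rightarrow> real \<Rightarrow> nat \<Rightarrow> (nat \<Rightarrow> 'a set) \<Rightarrow> bool" where
  "is_decomposition V E \<alpha> d L Z \<longleftrightarrow>
     (\<forall>i\<in>{1..L}. Z i \<subseteq> V) \<and>
     (\<forall>i\<in>{1..<L}. Z (i + 1) \<subseteq> Z i) \<and>
     Z 1 = V \<and>
     (\<forall>i\<in>{1..<L}.
        {v \<in> Z i. real (deg_in E v (Z i)) > \<alpha> * d} \<subseteq> Z (i + 1) \<and>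
        Z (i + 1) \<inter> {v \<in> Z i. real (deg_in E v (Z i)) < d} = {})"

end

theory Submission
  imports Defs
begin

text \<open>Counting degrees in \<open>Z\<^sub>i\<close> over the vertices that survive to \<open>Z\<^sub>i\<^sub>+\<^sub>1\<close> gives
  \<open>d |Z\<^sub>i\<^sub>+\<^sub>1| \<le> 2 |E(Z\<^sub>i)| = 2 \<rho>(Z\<^sub>i) |Z\<^sub>i|\<close>. Hence, as long as \<open>\<rho>(Z\<^sub>i) < d / (2 (1 + \<epsilon>))\<close>, the level sizes
  shrink by the factor \<open>1 + \<epsilon>\<close>, and after
  \<open>L - 1 > log (1 + \<epsilon>) n\<close> steps nothing is left. If
  \<open>d > 2 (1 + \<epsilon>) d\<^sup>*\<close>, this applies at every level. If \<open>\<alpha> d < d\<^sup>*\<close>, every vertex of a densest set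
  has degree at least \<open>d\<^sup>*\<close> inside it (otherwise deleting the vertex would increase the density),
  so the densest set survives in every level; \<open>Z\<^sub>L\<close> is then nonempty, and some level must have
  density at least \<open>d / (2 (1 + \<epsilon>))\<close>.\<close>

lemma finite_induced_edges: "finite S \<Longrightarrow> finite (induced_edges E S)"
  by (rule finite_subset[of _ "Pow S"]) (auto simp: induced_edges_def)

lemma density_nonneg: "density E S \<ge> 0"
  by (simp add: density_def)

lemma deg_in_mono: "finite T \<Longrightarrow> S \<subseteq> T \<Longrightarrow> deg_in E v S \<le> deg_in E v T"
  unfolding deg_in_def by (rule card_mono) auto

text \<open>Mapping a neighbour \<open>u\<close> of \<open>v\<close> to the edge
  \<open>{u, v}\<close> is a bijection. Counting incident edges instead of neighbours lets the
  degree enter both the double count in \<open>handshake\<close> and the splitting of an edge set at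
  \<open>v\<close>.\<close>

lemma deg_in_eq_incident:
  assumes "simple_graph V E" and "v \<in> S"
  shows "deg_in E v S = card {e \<in> induced_edges E S. v \<in> e}"
proof -
  have card2: "card e = 2" if "e \<in> E" for e
    using assms(1) that by (auto simp: simple_graph_def)
  have "bij_betw (\<lambda>u. {u, v}) {u \<in> S. {u, v} \<in> E} {e \<in> induced_edges E S. v \<in> e}"
  proof (rule bij_betw_imageI)
    show "inj_on (\<lambda>u. {u, v}) {u \<in> S. {u, v} \<in> E}"
      by (auto simp: inj_on_def doubleton_eq_iff)
    show "(\<lambda>u. {u, v}) ` {u \<in> S. {u, v} \<in> E} = {e \<in> induced_edges E S. v \<in> e}"
    proof (intro equalityI subsetI)
      fix e assume "e \<in> {e \<in> induced_edges E S. v \<in> e}"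
      then have e: "e \<in> E" "e \<subseteq> S" "v \<in> e"
        by (auto simp: induced_edges_def)
      then obtain u where "e = {u, v}"
        using card2[OF e(1)] by (auto simp: card_2_iff)
      then show "e \<in> (\<lambda>u. {u, v}) ` {u \<in> S. {u, v} \<in> E}"
        using e by auto
    qed (use assms(2) in \<open>auto simp: induced_edges_def\<close>)
  qed
  then show ?thesis
    unfolding deg_in_def by (rule bij_betw_same_card)
qed

lemma handshake:
  assumes "simple_graph V E" and "finite S"
  shows "(\<Sum>v\<in>S. deg_in E v S) = 2 * card (induced_edges E S)"
proof -
  have "(\<Sum>v\<in>S. deg_in E v S) = (\<Sum>v\<in>S. card {e \<in> induced_edges E S. v \<in> e})"
    by (rule sum.cong) (use assms(1) in \<open>auto intro: deg_in_eq_incident\<close>)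
  also have "\<dots> = 2 * card (induced_edges E S)"
  proof (rule sum_multicount[OF assms(2) finite_induced_edges[OF assms(2)]])
    show "\<forall>e\<in>induced_edges E S. card {v \<in> S. v \<in> e} = 2"
    proof
      fix e assume "e \<in> induced_edges E S"
      then have "card e = 2" "{v \<in> S. v \<in> e} = e"
        using assms(1) by (auto simp: induced_edges_def simple_graph_def)
      then show "card {v \<in> S. v \<in> e} = 2" by simp
    qed
  qed
  finally show ?thesis .
qed

lemma card_induced_edges_remove:
  assumes "simple_graph V E" and "finite S" and "v \<in> S"
  shows "card (induced_edges E S) = card (induced_edges E (S - {v})) + deg_in E v S"
proof -
  have "induced_edges E S = induced_edges E (S - {v}) \<union> {e \<in> induced_edges E S. v \<in> e}"
    by (auto simp: induced_edges_def)
  moreover have "card (induced_edges E (S - {v}) \<union> {e \<in> induced_edges E S. v \<in> e}) =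
      card (induced_edges E (S - {v})) + card {e \<in> induced_edges E S. v \<in> e}"
    by (rule card_Un_disjoint)
      (use assms(2) in \<open>auto simp: finite_induced_edges induced_edges_def[of E "S - {v}"]
        intro: finite_subset[OF _ finite_induced_edges[OF assms(2), of E]]\<close>)
  ultimately show ?thesis
    using deg_in_eq_incident[OF assms(1,3)] by simp
qed

text \<open>The product form also covers the empty set, where both sides are 0 because every edge
  has two endpoints. It spares case distinctions for sets \<open>Z i\<close> or
  \<open>S - {v}\<close> that may be empty.\<close>

lemma card_induced_edges_density:
  assumes "simple_graph V E" and "finite S"
  shows "real (card (induced_edges E S)) = density E S * real (card S)"
proof (cases "S = {}")
  case True
  have "induced_edges E {} = {}"
    using assms(1) by (auto simp: induced_edges_def simple_graph_def)
  with True show ?thesis by simp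
next
  case False
  then show ?thesis using assms(2) by (simp add: density_def)
qed

lemma finite_densities: "finite V \<Longrightarrow> finite {density E S | S. S \<subseteq> V \<and> S \<noteq> {}}"
  by (rule finite_subset[of _ "density E ` Pow V"]) auto

lemma max_density_attained:
  assumes "finite V" and "V \<noteq> {}"
  obtains S where "S \<subseteq> V" "S \<noteq> {}" "density E S = max_density V E"
proof -
  have "max_density V E \<in> {density E S | S. S \<subseteq> V \<and> S \<noteq> {}}"
    unfolding max_density_def
    by (rule Max_in) (use assms finite_densities in auto)
  then show ?thesis using that by (smt (verit) mem_Collect_eq)
qed

lemma density_le_max_density:
  assumes "finite V" and "V \<noteq> {}" and "S \<subseteq> V"
  shows "density E S \<le> max_density V E"
proof (cases "S = {}")
  \<comment> \<open>The empty set is not among the sets maximised over, but its density is 0 by the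
    convention \<open>x / 0 = 0\<close>, so nonnegativity of the maximum suffices.\<close>
  case True
  obtain T where "density E T = max_density V E"
    using max_density_attained[OF assms(1,2)] by blast
  then have "max_density V E \<ge> 0"
    using density_nonneg[of E T] by simp
  with True show ?thesis by (simp add: density_def)
next
  case False
  then show ?thesis
    unfolding max_density_def
    by (intro Max_ge finite_densities) (use assms in auto)
qed

lemma max_density_le_deg_in_densest:
  assumes "simple_graph V E" and "S \<subseteq> V" and "density E S = max_density V E" and "v \<in> S"
  shows "max_density V E \<le> real (deg_in E v S)"
proof -
  let ?m = "max_density V E"
  have fin: "finite V" "finite S"
    using assms(1,2) by (auto simp: simple_graph_def intro: finite_subset)
  have "density E (S - {v}) \<le> ?m"
    using density_le_max_density[OF fin(1), of "S - {v}"] assms(2,4) by blast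
  then have "real (card (induced_edges E (S - {v}))) \<le> ?m * real (card (S - {v}))"
    using fin by (simp add: card_induced_edges_density[OF assms(1)] mult_right_mono)
  moreover have "real (card S) = real (card (S - {v})) + 1"
    using card_Suc_Diff1[OF fin(2) assms(4)] by linarith
  moreover have "real (card (induced_edges E S)) = ?m * real (card S)"
    using card_induced_edges_density[OF assms(1) fin(2)] assms(3) by simp
  \<comment> \<open>With \<open>m\<close> for the maximum, m |S| = |E(S)| = |E(S - {v})| + deg v <=
    m (|S| - 1) + deg v, and m (|S| - 1) cancels. No division occurs, so \<open>S = {v}\<close> is
    covered.\<close>
  ultimately show ?thesis
    using card_induced_edges_remove[OF assms(1) fin(2) assms(4)]
    by (simp add: algebra_simps)
qed

lemma decomposition_shrink:
  assumes "simple_graph V E" and "is_decomposition V E \<alpha> d L Z" and "i \<in> {1..<L}"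
  shows "d * real (card (Z (Suc i))) \<le> 2 * density E (Z i) * real (card (Z i))"
proof -
  have dec: "Z i \<subseteq> V" "Z (Suc i) \<subseteq> Z i"
      "Z (Suc i) \<inter> {v \<in> Z i. real (deg_in E v (Z i)) < d} = {}"
    using assms(2,3) by (auto simp: is_decomposition_def)
  have fin: "finite (Z i)"
    using assms(1) dec(1) by (auto simp: simple_graph_def intro: finite_subset)
  have "d * real (card (Z (Suc i))) = (\<Sum>v\<in>Z (Suc i). d)"
    by simp
  \<comment> \<open>Degrees are taken in \<open>Z i\<close>, where the low-degree test was made;
    they may be smaller in \<open>Z (Suc i)\<close>.\<close>
  also have "\<dots> \<le> (\<Sum>v\<in>Z (Suc i). real (deg_in E v (Z i)))"
    using dec by (intro sum_mono) force
  also have "\<dots> \<le> (\<Sum>v\<in>Z i. real (deg_in E v (Z i)))"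
    by (intro sum_mono2 fin dec(2)) simp
  also have "\<dots> = real (2 * card (induced_edges E (Z i)))"
    using handshake[OF assms(1) fin] by (metis of_nat_sum)
  also have "\<dots> = 2 * density E (Z i) * real (card (Z i))"
    by (simp add: card_induced_edges_density[OF assms(1) fin])
  finally show ?thesis .
qed

lemma last_level_empty:
  fixes \<epsilon> :: real
  assumes "simple_graph V E" and "is_decomposition V E \<alpha> d L Z" and "V \<noteq> {}" and "0 < \<epsilon>"
    and L: "L = 2 + nat \<lceil>log (1 + \<epsilon>) (real (card V))\<rceil>"
    and sparse: "\<And>i. i \<in> {1..<L} \<Longrightarrow> density E (Z i) < d / (2 * (1 + \<epsilon>))"
  shows "Z L = {}"
proof -
  let ?n = "real (card V)"
  have fin: "finite V" using assms(1) by (simp add: simple_graph_def)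
  then have npos: "?n > 0" using assms(3) by (simp add: card_gt_0_iff)
  have Z1: "Z 1 = V" and ZV: "Z L \<subseteq> V"
    using assms(2) L by (auto simp: is_decomposition_def)
  \<comment> \<open>Since \<open>L\<close> is at least 2, level 1 is sparse, and its nonnegative
    density forces \<open>d > 0\<close>. This permits cancelling \<open>d\<close> below.\<close>
  have "d / (2 * (1 + \<epsilon>)) > 0"
    using sparse[of 1] density_nonneg[of E "Z 1"] L by simp
  then have dpos: "d > 0"
    using assms(4) by (simp add: zero_less_divide_iff)
  have shrink: "(1 + \<epsilon>) * real (card (Z (Suc i))) \<le> real (card (Z i))" if i: "i \<in> {1..<L}" for i
  proof -
    have "d * real (card (Z (Suc i))) \<le> 2 * density E (Z i) * real (card (Z i))"
      by (rule decomposition_shrink[OF assms(1,2) i])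
    also have "\<dots> \<le> d / (1 + \<epsilon>) * real (card (Z i))"
      using sparse[OF i] assms(4) by (intro mult_right_mono) (auto simp: field_simps)
    finally have "d * ((1 + \<epsilon>) * real (card (Z (Suc i)))) \<le> d * real (card (Z i))"
      using assms(4) by (simp add: field_simps)
    then show ?thesis using dpos by simp
  qed
  have size: "(1 + \<epsilon>) ^ k * real (card (Z (Suc k))) \<le> ?n" if "Suc k \<le> L" for k
    using that
  proof (induction k)
    case 0
    then show ?case using Z1 by simp
  next
    case (Suc k)
    have "(1 + \<epsilon>) ^ Suc k * real (card (Z (Suc (Suc k)))) =
        (1 + \<epsilon>) ^ k * ((1 + \<epsilon>) * real (card (Z (Suc (Suc k)))))"
      by simp
    also have "\<dots> \<le> (1 + \<epsilon>) ^ k * real (card (Z (Suc k)))"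
      using Suc.prems assms(4) by (intro mult_left_mono shrink) auto
    also have "\<dots> \<le> ?n" using Suc by simp
    finally show ?case .
  qed
  \<comment> \<open>This explains the 2 in \<open>L\<close>: one unit pays for \<open>L\<close>
    levels having only \<open>L - 1\<close> steps between them, the other makes the inequality
    strict. So the size of \<open>Z L\<close> is below 1, hence 0.\<close>
  have "log (1 + \<epsilon>) ?n < real (L - 1)"
    using L by linarith
  then have "?n < (1 + \<epsilon>) powr real (L - 1)"
    using assms(4) npos by (simp add: log_less_iff)
  then have "?n < (1 + \<epsilon>) ^ (L - 1)"
    using assms(4) by (simp add: powr_realpow)
  moreover have "(1 + \<epsilon>) ^ (L - 1) * real (card (Z L)) \<le> ?n"
    using size[of "L - 1"] L by simp
  ultimately have "(1 + \<epsilon>) ^ (L - 1) * real (card (Z L)) < (1 + \<epsilon>) ^ (L - 1) * 1"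
    by linarith
  then have "card (Z L) = 0"
    using assms(4) by (simp add: mult_less_cancel_left_pos)
  then show ?thesis
    using finite_subset[OF ZV fin] by simp
qed

text \<open>Once \<open>S\<close> lies inside \<open>Z i\<close>, degrees in \<open>Z i\<close>
  dominate those in \<open>S\<close>, which exceed \<open>\<alpha> * d\<close>; the retention rule
  then keeps all of \<open>S\<close> for the next level.\<close>

lemma densest_subset_level:
  assumes "simple_graph V E" and "is_decomposition V E \<alpha> d L Z" and "\<alpha> * d < max_density V E"
    and "S \<subseteq> V" and "density E S = max_density V E" and "1 \<le> i" and "i \<le> L"
  shows "S \<subseteq> Z i"
  using assms(6,7)
proof (induction i rule: dec_induct)
  case base
  then show ?case using assms(2,4) by (simp add: is_decomposition_def)
next
  case (step i)
  then have i: "i \<in> {1..<L}" and sub: "S \<subseteq> Z i" by auto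
  have dec: "Z i \<subseteq> V" "{v \<in> Z i. real (deg_in E v (Z i)) > \<alpha> * d} \<subseteq> Z (Suc i)"
    using assms(2) i by (auto simp: is_decomposition_def)
  have fin: "finite (Z i)"
    using assms(1) dec(1) by (auto simp: simple_graph_def intro: finite_subset)
  show ?case
  proof
    fix v assume v: "v \<in> S"
    have "\<alpha> * d < real (deg_in E v S)"
      using max_density_le_deg_in_densest[OF assms(1,4,5) v] assms(3) by linarith
    also have "\<dots> \<le> real (deg_in E v (Z i))"
      using deg_in_mono[OF fin sub] by simp
    finally show "v \<in> Z (Suc i)" using dec(2) sub v by auto
  qed
qed

theorem theorem2p6:
  fixes V :: "'a set" and E :: "'a set set" and Z :: "nat \<Rightarrow> 'a set"
    and n L :: nat and \<alpha> d \<epsilon> dstar :: real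
  assumes "simple_graph V E" and "V \<noteq> {}" and "card V = n"
    and "\<alpha> \<ge> 1" and "d \<ge> 0" and "0 < \<epsilon>" and "\<epsilon> < 1"
    and "L = 2 + nat \<lceil>log (1 + \<epsilon>) (real n)\<rceil>"
    and "dstar = max_density V E"
    and "is_decomposition V E \<alpha> d L Z"
  shows "(d > 2 * (1 + \<epsilon>) * dstar \<longrightarrow> Z L = {}) \<and>
         (\<not> d > 2 * (1 + \<epsilon>) * dstar \<and> d < dstar / \<alpha> \<longrightarrow>
            Z L \<noteq> {} \<and> (\<exists>j\<in>{1..L - 1}. density E (Z j) \<ge> d / (2 * (1 + \<epsilon>))))"
proof (intro conjI impI; (elim conjE)?)
  have fin: "finite V" using assms(1) by (simp add: simple_graph_def)
  have L: "L = 2 + nat \<lceil>log (1 + \<epsilon>) (real (card V))\<rceil>"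
    using assms(3,8) by simp
  \<comment> \<open>The sparsity of all levels remains as a premise. The first claim proves it from
    the global density bound; the second assumes it for contradiction.\<close>
  note empty = last_level_empty[OF assms(1,10,2,6) L]
  {
    assume d: "d > 2 * (1 + \<epsilon>) * dstar"
    have "density E (Z i) < d / (2 * (1 + \<epsilon>))" if "i \<in> {1..<L}" for i
    proof -
      have "Z i \<subseteq> V" using assms(10) that by (auto simp: is_decomposition_def)
      then have "density E (Z i) \<le> dstar"
        using density_le_max_density[OF fin assms(2)] assms(9) by simp
      also have "\<dots> < d / (2 * (1 + \<epsilon>))"
        using d assms(6) by (simp add: field_simps)
      finally show ?thesis .
    qed
    then show "Z L = {}" by (rule empty)
  next
    assume "d < dstar / \<alpha>"
    then have less: "\<alpha> * d < max_density V E"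
      using assms(4,9) by (simp add: field_simps)
    obtain S where S: "S \<subseteq> V" "S \<noteq> {}" "density E S = max_density V E"
      using max_density_attained[OF fin assms(2)] .
    have "S \<subseteq> Z L"
      by (rule densest_subset_level[OF assms(1,10) less S(1,3)]) (use L in auto)
    with S(2) show nonempty: "Z L \<noteq> {}" by auto
    show "\<exists>j\<in>{1..L - 1}. density E (Z j) \<ge> d / (2 * (1 + \<epsilon>))"
    proof (rule ccontr)
      assume "\<not> ?thesis"
      then have "density E (Z i) < d / (2 * (1 + \<epsilon>))" if "i \<in> {1..<L}" for i
        using that by (force simp: not_le)
      then have "Z L = {}" by (rule empty)
      with nonempty show False ..
    qed
  }
qed

end
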